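(* Let $p$ be a prime and let $n\ge 0$ be an integer. Then $p$ divides $F(p,n)$, unless $n$ is of the form $\frac{p^k-1}{p-1}$ with $k\in\mathbb{N}$, in which case $F(p,n)\equiv 1\pmod p$.
   Context: For integers $s\ge 1$ and $n\ge 0$, the $s$-Catalan number is the integer $F(s,n)=\frac{1}{(s-1)n+1}\binom{sn}{n}$. Here $\mathbb{N}=\{0,1,2,\dots\}$. *)

theory Defs
  imports Complex_Main "HOL-Number_Theory.Cong" "HOL-Computational_Algebra.Primes"
begin

definition s_catalan :: "nat \<Rightarrow> nat \<Rightarrow> nat" where
  "s_catalan s n = ((s * n) choose n) div ((s - 1) * n + 1)"

text \<open>The natural-number division above is exact, so no truncation takes place for \<open>s \<ge> 1\<close>.\<close>

lemma s_catalan_dvd: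
  assumes "s \<ge> 1"
  shows "(s - 1) * n + 1 dvd ((s * n) choose n)"
proof -
  define m where "m = (s - 1) * n"
  have N: "s * n = m + n"
    using assms by (cases s) (simp_all add: m_def)
  have sym: "(m + n) choose n = (m + n) choose m"
    using binomial_symmetric[of n "m + n"] by simp
  have "Suc m * ((m + n) choose Suc m) = n * ((m + n) choose m)"
    using binomial_absorb_comp[of "m + n" m] binomial_absorption[of m "m + n"] by simp
  then have "m + 1 dvd n * ((m + n) choose n)"
    unfolding sym by (metis Suc_eq_plus1 dvd_triv_left)
  moreover have "coprime (m + 1) n"
    unfolding m_def by (metis coprime_1_left coprime_iff_gcd_eq_1 gcd_add_mult gcd.commute add.commute)
  ultimately have "m + 1 dvd ((m + n) choose n)"
    by (simp add: coprime_dvd_mult_right_iff)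
  then show ?thesis
    unfolding N m_def[symmetric] .
qed

lemma s_catalan_rat:
  assumes "s \<ge> 1"
  shows "rat_of_nat (s_catalan s n) =
    1 / ((rat_of_nat s - 1) * rat_of_nat n + 1) * rat_of_nat ((s * n) choose n)"
proof -
  have d: "rat_of_nat ((s - 1) * n + 1) = (rat_of_nat s - 1) * rat_of_nat n + 1"
    using assms by (simp add: of_nat_diff)
  have "(s * n) choose n = ((s - 1) * n + 1) * s_catalan s n"
    unfolding s_catalan_def using s_catalan_dvd[OF assms, of n] by (simp only: dvd_mult_div_cancel)
  then have "rat_of_nat ((s * n) choose n) =
      rat_of_nat ((s - 1) * n + 1) * rat_of_nat (s_catalan s n)"
    by (simp only: of_nat_mult)
  moreover have "rat_of_nat ((s - 1) * n + 1) \<noteq> 0"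
    by (simp only: of_nat_eq_0_iff)
  ultimately show ?thesis
    unfolding d by simp
qed

text \<open>The quotient \<open>(p ^ k - 1) div (p - 1)\<close> is likewise exact.\<close>

lemma repunit_dvd:
  fixes p k :: nat
  shows "p - 1 dvd p ^ k - 1"
proof (cases "p = 0")
  case True
  then show ?thesis by (cases k) simp_all
next
  case False
  then have "[p = 1] (mod (p - 1))"
    by (simp add: cong_altdef_nat)
  then have "[p ^ k = 1] (mod (p - 1))"
    using cong_pow by fastforce
  then show ?thesis
    using False by (simp add: cong_altdef_nat)
qed

end

theory Submission
  imports Defs
begin

text \<open>
Write \<open>F n\<close> for \<open>s_catalan p n\<close>. The identity \<open>(p n + 1) F(n) = C(p n + 1, n)\<close> removes the
denominator modulo \<open>p\<close>: \<open>F(n)\<close> is congruent to \<open>C(p n + 1, n) = C(p n, n) + C(p n, n - 1)\<close>.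
The upper indices on the right are multiples of \<open>p\<close>, so only lower indices that are
multiples of \<open>p\<close> contribute, and there \<open>C(p n, p m)\<close> is congruent to \<open>C(n, m)\<close>. The result depends
on the last digit of \<open>n\<close> in base \<open>p\<close>:

\<^item> if that digit is at least 2, neither summand survives and \<open>p\<close> divides \<open>F(n)\<close>;
\<^item> if \<open>n = p m + 1\<close>, what survives is \<open>C(p m + 1, m)\<close>, which is congruent to \<open>F(m)\<close>;
\<^item> if \<open>n = p m\<close>, what survives is \<open>C(p m, m) = ((p - 1) m + 1) F(m)\<close>.

The numbers \<open>(p ^ k - 1) div (p - 1)\<close> are exactly those obtained from 0 by iterating the map taking
\<open>m\<close> to \<open>p m + 1\<close>, and \<open>F(0) = 1\<close>, so the second case gives the value 1 on all of them. For any
other \<open>n\<close>, strip digits by induction. The digit 1 leads to a smaller number that is again not of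
this form. The digit 0 may lead to \<open>m = (p ^ k - 1) div (p - 1)\<close>, but then \<open>k \<ge> 1\<close>
because \<open>m > 0\<close>, so \<open>m\<close> is 1 modulo \<open>p\<close> and the factor \<open>(p - 1) m + 1\<close> vanishes.
\<close>

lemma prime_dvd_mult_choose:
  fixes p n j :: nat
  assumes "prime p" and "\<not> p dvd j"
  shows "p dvd (p * n choose j)"
proof -
  have "j > 0"
    using assms(2) by (cases j) auto
  then have "j * (p * n choose j) = p * n * (p * n - 1 choose (j - 1))"
    by (rule times_binomial_minus1_eq)
  then have "p dvd j * (p * n choose j)"
    by simp
  then show ?thesis
    using assms prime_dvd_mult_nat by blast
qed

text \<open>
This is the Lucas congruence for a top index and a bottom index that both end in the digit 0.
Splitting off \<open>p\<close> of the \<open>p * Suc n\<close> elements by Vandermonde's identity, only the terms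
that take none or all of the \<open>p\<close> elements survive modulo \<open>p\<close>, and the two survivors obey
Pascal's rule.
\<close>

lemma choose_mult_prime_cong:
  fixes p n m :: nat
  assumes "prime p"
  shows "[p * n choose (p * m) = n choose m] (mod p)"
proof (induction n arbitrary: m)
  case 0
  show ?case
    using prime_gt_0_nat[OF assms] by (cases "m = 0") (simp_all add: binomial_eq_0)
next
  case (Suc n)
  show ?case
  proof (cases m)
    case 0
    then show ?thesis by simp
  next
    case (Suc l)
    have p: "0 < p"
      using prime_gt_0_nat[OF assms] .
    have inner: "p dvd (p choose i) * (p * n choose (p * m - i))"
      if "i \<in> {..p * m} - {0, p}" for i
    proof -
      have "\<not> p dvd i \<or> i > p"
        using that by (metis Diff_iff dvd_imp_le insertCI linorder_neqE_nat not_gr_zero not_less)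
      then show ?thesis
        using prime_dvd_mult_choose[OF assms, of i 1] by (auto simp: binomial_eq_0)
    qed
    have "p * Suc n choose (p * m) = (\<Sum>i\<le>p * m. (p choose i) * (p * n choose (p * m - i)))"
      using vandermonde[of p "p * n" "p * m"] by simp
    also have "\<dots> = (\<Sum>i\<in>{..p * m} - {0, p}. (p choose i) * (p * n choose (p * m - i)))
        + (\<Sum>i\<in>{0, p}. (p choose i) * (p * n choose (p * m - i)))"
      using Suc by (intro sum.subset_diff) auto
    also have "(\<Sum>i\<in>{0, p}. (p choose i) * (p * n choose (p * m - i)))
        = (p * n choose (p * m)) + (p * n choose (p * l))"
      using p Suc by simp
    also have "[(\<Sum>i\<in>{..p * m} - {0, p}. (p choose i) * (p * n choose (p * m - i)))
        + ((p * n choose (p * m)) + (p * n choose (p * l)))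
        = 0 + ((n choose m) + (n choose l))] (mod p)"
      using inner by (intro cong_add Suc.IH) (auto simp: cong_0_iff intro!: dvd_sum)
    finally show ?thesis
      using Suc by (simp add: add.commute)
  qed
qed

lemma s_catalan_mult_eq:
  assumes "s \<ge> 1"
  shows "s * n choose n = ((s - 1) * n + 1) * s_catalan s n"
  unfolding s_catalan_def using s_catalan_dvd[OF assms, of n]
  by (simp only: dvd_mult_div_cancel)

text \<open>
Unlike \<open>(s - 1) * n + 1\<close> in the definition, the factor \<open>s * n + 1\<close> is 1 modulo \<open>s\<close>, so it
disappears in a congruence modulo \<open>s\<close>. The two forms are related by the absorption identity for
binomial coefficients.
\<close>

lemma s_catalan_mult_eq_Suc:
  assumes "s \<ge> 1"
  shows "(s * n + 1) * s_catalan s n = Suc (s * n) choose n"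
proof -
  define m where "m = (s - 1) * n"
  have N: "s * n = m + n"
    using assms by (cases s) (simp_all add: m_def)
  have "Suc m * (Suc (m + n) choose n) = Suc (m + n) * (m + n choose n)"
    using binomial_absorb_comp[of "Suc (m + n)" n] by (simp add: Suc_diff_le)
  also have "m + n choose n = Suc m * s_catalan s n"
    using s_catalan_mult_eq[OF assms, of n] by (simp only: N m_def[symmetric] Suc_eq_plus1)
  also have "Suc (m + n) * (Suc m * s_catalan s n) = Suc m * (Suc (m + n) * s_catalan s n)"
    by (simp only: mult.left_commute)
  finally show ?thesis
    unfolding N by (simp only: mult_cancel1) simp
qed

lemma s_catalan_prime_cong_choose:
  assumes "prime p"
  shows "[s_catalan p n = Suc (p * n) choose n] (mod p)"
proof -
  have "[(p * n + 1) * s_catalan p n = (0 + 1) * s_catalan p n] (mod p)"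
    by (intro cong_mult cong_add) (auto simp: cong_0_iff)
  then show ?thesis
    using s_catalan_mult_eq_Suc[of p n] prime_ge_1_nat[OF assms] by (simp add: cong_sym)
qed

text \<open>
The factor \<open>(p - 1) * m + 1\<close> is kept, although \<open>p * m choose m\<close> is a shorter right-hand side:
it is the reason why the last digit 0 forces divisibility even if \<open>s_catalan p m\<close> is 1
modulo \<open>p\<close>.
\<close>

lemma s_catalan_prime_mult:
  assumes "prime p"
  shows "[s_catalan p (p * m) = ((p - 1) * m + 1) * s_catalan p m] (mod p)"
proof (cases m)
  case 0
  then show ?thesis by (simp add: s_catalan_def)
next
  case (Suc l)
  define j where "j = p * m - 1"
  have j: "p * m = Suc j"
    using Suc prime_gt_0_nat[OF assms] by (simp add: j_def)
  have "\<not> p dvd j"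
  proof
    assume "p dvd j"
    moreover have "p dvd Suc j"
      using j by (metis dvd_triv_left)
    ultimately have "p dvd 1"
      using dvd_diff_nat[of p "Suc j" j] by simp
    then show False
      using assms by simp
  qed
  then have "[(p * (p * m) choose j) + (p * (p * m) choose (p * m)) = 0 + (p * m choose m)] (mod p)"
    by (intro cong_add choose_mult_prime_cong assms)
       (simp add: cong_0_iff prime_dvd_mult_choose assms)
  moreover have "Suc (p * (p * m)) choose (p * m)
      = (p * (p * m) choose j) + (p * (p * m) choose (p * m))"
    by (simp only: j binomial_Suc_Suc)
  ultimately have "[s_catalan p (p * m) = p * m choose m] (mod p)"
    using s_catalan_prime_cong_choose[OF assms, of "p * m"] by (metis add_0 cong_trans)
  then show ?thesis
    using s_catalan_mult_eq[of p m] prime_ge_1_nat[OF assms] by simp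
qed

lemma s_catalan_prime_mult_add_1:
  assumes "prime p"
  shows "[s_catalan p (p * m + 1) = s_catalan p m] (mod p)"
proof -
  let ?N = "p * (p * m + 1)"
  have "\<not> p dvd Suc (p * m)"
    using assms by (metis Suc_eq_plus1 dvd_add_right_iff dvd_triv_left not_prime_unit)
  then have "[(?N choose (p * m)) + (?N choose Suc (p * m)) = (p * m + 1 choose m) + 0] (mod p)"
    by (intro cong_add choose_mult_prime_cong assms)
       (simp add: cong_0_iff prime_dvd_mult_choose assms del: mult_Suc_right)
  moreover have "Suc ?N choose (p * m + 1) = (?N choose (p * m)) + (?N choose Suc (p * m))"
    by simp
  ultimately have "[s_catalan p (p * m + 1) = Suc (p * m) choose m] (mod p)"
    using s_catalan_prime_cong_choose[OF assms, of "p * m + 1"]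
    by (metis Suc_eq_plus1 add_0_right cong_trans)
  then show ?thesis
    using s_catalan_prime_cong_choose[OF assms, of m] by (metis cong_sym cong_trans)
qed

text \<open>Here neither \<open>n\<close> nor \<open>n - 1\<close> is a multiple of \<open>p\<close>, so both Pascal summands vanish.\<close>

lemma prime_dvd_s_catalan:
  assumes "prime p" and "n mod p > 1"
  shows "p dvd s_catalan p n"
proof -
  obtain j where j: "n = Suc j"
    using assms(2) by (cases n) auto
  have "\<not> p dvd n"
    using assms(2) by (auto simp: dvd_eq_mod_eq_0)
  moreover have "\<not> p dvd j"
  proof
    assume "p dvd j"
    then have "n mod p = 1 mod p"
      unfolding j by (metis Suc_eq_plus1 dvd_imp_mod_0 mod_Suc_eq One_nat_def)
    then show False
      using assms(2) by (metis mod_less_eq_dividend not_less)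
  qed
  ultimately have "p dvd (p * n choose j) + (p * n choose n)"
    by (intro dvd_add prime_dvd_mult_choose assms(1))
  then have "p dvd Suc (p * n) choose n"
    by (simp add: j del: mult_Suc_right)
  then show ?thesis
    using cong_dvd_iff s_catalan_prime_cong_choose[OF assms(1)] by blast
qed

lemma repunit_Suc:
  fixes p k :: nat
  assumes "p > 1"
  shows "(p ^ Suc k - 1) div (p - 1) = p * ((p ^ k - 1) div (p - 1)) + 1"
proof -
  define R where "R = (p ^ k - 1) div (p - 1)"
  have "p ^ k = (p - 1) * R + 1"
    using repunit_dvd[of p k] assms by (simp add: R_def)
  then have "p ^ Suc k - 1 = (p - 1) * (p * R + 1)"
    using assms by (simp add: algebra_simps)
  then have "(p ^ Suc k - 1) div (p - 1) = p * R + 1"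
    using assms by (simp only: nonzero_mult_div_cancel_left)
  then show ?thesis
    by (simp only: R_def)
qed

theorem theorem4:
  fixes p n :: nat
  assumes "prime p"
  shows "((\<nexists>k::nat. n = (p ^ k - 1) div (p - 1)) \<longrightarrow> p dvd s_catalan p n) \<and>
         ((\<exists>k::nat. n = (p ^ k - 1) div (p - 1)) \<longrightarrow> [s_catalan p n = 1] (mod p))"
proof -
  define rep where "rep k = (p ^ k - 1) div (p - 1)" for k
  have p: "p > 1"
    using prime_gt_1_nat[OF assms] .
  have rep_0: "rep 0 = 0"
    by (simp add: rep_def)
  have rep_Suc: "rep (Suc k) = p * rep k + 1" for k
    unfolding rep_def by (rule repunit_Suc[OF p])
  have repunit: "[s_catalan p (rep k) = 1] (mod p)" for k
  proof (induction k)
    case 0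
    then show ?case by (simp add: rep_0 s_catalan_def)
  next
    case (Suc k)
    then show ?case
      unfolding rep_Suc using s_catalan_prime_mult_add_1[OF assms] cong_trans by blast
  qed
  have "n \<notin> range rep \<Longrightarrow> p dvd s_catalan p n"
  proof (induction n rule: less_induct)
    case (less n)
    define m where "m = n div p"
    have n: "n = p * m + n mod p"
      by (simp add: m_def)
    have "n > 0"
      using less.prems rep_0 by (metis gr0I rangeI)
    then have "m < n"
      using p by (simp add: m_def)
    consider "n mod p > 1" | "n mod p = 1" | "n mod p = 0"
      by linarith
    then show ?case
    proof cases
      case 1
      then show ?thesis
        by (rule prime_dvd_s_catalan[OF assms])
    next
      case 2
      then have n1: "n = p * m + 1"
        using n by simp
      then have "m \<notin> range rep"
        using less.prems rep_Suc by (metis image_iff UNIV_I)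
      then show ?thesis
        using less.IH[OF \<open>m < n\<close>] s_catalan_prime_mult_add_1[OF assms, of m] cong_dvd_iff
        unfolding n1 by blast
    next
      case 3
      then have n0: "n = p * m"
        using n by simp
      have "p dvd ((p - 1) * m + 1) * s_catalan p m"
      proof (cases "m \<in> range rep")
        case True
        then obtain k where "m = rep k" by blast
        moreover have "m \<noteq> 0"
          using n0 \<open>n > 0\<close> by simp
        \<comment> \<open>As \<open>m \<noteq> 0\<close> it is the successor of another repunit, hence 1 modulo \<open>p\<close>.\<close>
        ultimately obtain l where "m = p * rep l + 1"
          using rep_0 rep_Suc by (metis not0_implies_Suc)
        then have "(p - 1) * m + 1 = p * ((p - 1) * rep l + 1)"
          using p by (cases p) (simp_all add: algebra_simps)
        then show ?thesis by simp
      next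
        case False
        then show ?thesis
          using less.IH[OF \<open>m < n\<close>] by simp
      qed
      then show ?thesis
        using s_catalan_prime_mult[OF assms, of m] cong_dvd_iff unfolding n0 by blast
    qed
  qed
  then show ?thesis
    using repunit unfolding rep_def by blast
qed

end
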